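(* Let $(M;\vee,\wedge,\oplus,0)$ be an $EMV$-algebra. Then the set $(\mathrm{Ideal}(M);\subseteq)$ of all ideals of $M$ ordered by inclusion is a complete Brouwer lattice. Consequently, the variety $\mathbb{EMV}$ of all $EMV$-algebras is congruence distributive, i.e. for every $EMV$-algebra $M$ the lattice $(\mathrm{Con}(M);\subseteq)$ of congruences on $M$ is distributive.
   Context: An algebra $(M;\vee,\wedge,\oplus,0)$ of type $(2,2,2,0)$ is an $EMV$-algebra if: (1) $(M;\vee,\wedge,0)$ is a distributive lattice with least element $0$; (2) $(M;\oplus,0)$ is a commutative ordered monoid with neutral element $0$; (3) writing $\mathcal I(M)=\{a\in M: a\oplus a=a\}$, for all $a\le b$ in $\mathcal I(M)$ and all $x\in[a,b]$ the element $\lambda_{a,b}(x)=\min\{z\in[a,b]: x\oplus z=b\}$ exists in $M$, and $([a,b];\oplus,\lambda_{a,b},a,b)$ is an $MV$-algebra; (4) each $x\in M$ lies below some $a\in\mathcal I(M)$. We write $\lambda_b:=\lambda_{0,b}$. An ideal of $M$ is a non-empty down-closed subset closed under $\oplus$. A congruence on $M$ is an equivalence relation $\theta$ compatible with $\vee,\wedge,\oplus$ such that for all $b\in\mathcal I(M)$, $\theta\cap([0,b]\times[0,b])$ is a congruence of the $MV$-algebra $([0,b];\oplus,\lambda_b,0,b)$. A complete Brouwer lattice is a complete lattice in which binary meets distribute over arbitrary joins: $I\wedge\bigvee_{i}J_i=\bigvee_i(I\wedge J_i)$. *)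

theory Defs
  imports "HOL-Algebra.Group"
begin

section \<open>Lattices as ordered sets\<close>

locale distributive_lattice = lattice +
  assumes meet_join_distrib:
    "\<lbrakk>x \<in> carrier L; y \<in> carrier L; z \<in> carrier L\<rbrakk>
      \<Longrightarrow> x \<sqinter> (y \<squnion> z) = (x \<sqinter> y) \<squnion> (x \<sqinter> z)"

text \<open>Joins of families \<open>(J\<^sub>i)\<close> are joins of their sets of values; the empty family is included.\<close>

locale complete_Brouwer_lattice = complete_lattice +
  assumes meet_Sup_distrib:
    "\<lbrakk>x \<in> carrier L; A \<subseteq> carrier L\<rbrakk> \<Longrightarrow> x \<sqinter> (\<Squnion>A) = \<Squnion>((\<lambda>y. x \<sqinter> y) ` A)"

section \<open>MV-algebras\<close>

record 'a mv = "'a partial_object" +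
  mv_plus :: "'a \<Rightarrow> 'a \<Rightarrow> 'a"
  mv_neg :: "'a \<Rightarrow> 'a"
  mv_zero :: 'a
  mv_one :: 'a

locale mv_algebra =
  fixes A :: "('a, 'b) mv_scheme"
  assumes comm_monoid:
      "comm_monoid \<lparr>carrier = carrier A, mult = mv_plus A, one = mv_zero A\<rparr>"
    and one_closed: "mv_one A \<in> carrier A"
    and neg_closed: "x \<in> carrier A \<Longrightarrow> mv_neg A x \<in> carrier A"
    and neg_zero: "mv_neg A (mv_zero A) = mv_one A"
    and neg_neg: "x \<in> carrier A \<Longrightarrow> mv_neg A (mv_neg A x) = x"
    and plus_one: "x \<in> carrier A \<Longrightarrow> mv_plus A x (mv_one A) = mv_one A"
    and Lukasiewicz:
      "\<lbrakk>x \<in> carrier A; y \<in> carrier A\<rbrakk>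
        \<Longrightarrow> mv_plus A (mv_neg A (mv_plus A (mv_neg A x) y)) y
          = mv_plus A (mv_neg A (mv_plus A (mv_neg A y) x)) x"

definition compatible2 :: "('a \<Rightarrow> 'a \<Rightarrow> 'a) \<Rightarrow> ('a \<times> 'a) set \<Rightarrow> bool" where
  "compatible2 f \<theta> \<longleftrightarrow>
    (\<forall>x x' y y'. (x, x') \<in> \<theta> \<longrightarrow> (y, y') \<in> \<theta> \<longrightarrow> (f x y, f x' y') \<in> \<theta>)"

definition mv_congruence :: "('a, 'b) mv_scheme \<Rightarrow> ('a \<times> 'a) set \<Rightarrow> bool" where
  "mv_congruence A \<theta> \<longleftrightarrow>
    equiv (carrier A) \<theta> \<and>
    compatible2 (mv_plus A) \<theta> \<and>
    (\<forall>x y. (x, y) \<in> \<theta> \<longrightarrow> (mv_neg A x, mv_neg A y) \<in> \<theta>)"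

section \<open>EMV-algebras\<close>

record 'a emv = "'a partial_object" +
  emv_join :: "'a \<Rightarrow> 'a \<Rightarrow> 'a" (infixl \<open>\<^bold>\<or>\<index>\<close> 65)
  emv_meet :: "'a \<Rightarrow> 'a \<Rightarrow> 'a" (infixl \<open>\<^bold>\<and>\<index>\<close> 70)
  emv_plus :: "'a \<Rightarrow> 'a \<Rightarrow> 'a" (infixl \<open>\<oplus>\<index>\<close> 65)
  emv_zero :: 'a (\<open>\<zero>\<index>\<close>)

definition emv_order :: "('a, 'b) emv_scheme \<Rightarrow> 'a gorder" where
  "emv_order M = \<lparr>carrier = carrier M, eq = (=), le = (\<lambda>x y. x \<^bold>\<and>\<^bsub>M\<^esub> y = x)\<rparr>"

definition emv_idempotents :: "('a, 'b) emv_scheme \<Rightarrow> 'a set" where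
  "emv_idempotents M = {a \<in> carrier M. a \<oplus>\<^bsub>M\<^esub> a = a}"

definition emv_interval :: "('a, 'b) emv_scheme \<Rightarrow> 'a \<Rightarrow> 'a \<Rightarrow> 'a set" where
  "emv_interval M a b = \<lbrace>a..b\<rbrace>\<^bsub>emv_order M\<^esub>"

definition emv_compl_candidates :: "('a, 'b) emv_scheme \<Rightarrow> 'a \<Rightarrow> 'a \<Rightarrow> 'a \<Rightarrow> 'a set" where
  "emv_compl_candidates M a b x = {z \<in> emv_interval M a b. x \<oplus>\<^bsub>M\<^esub> z = b}"

text \<open>\<open>emv_compl M a b\<close> is \<open>\<lambda>\<^bsub>a,b\<^esub>\<close>; the minimum is unique once it exists, and its
  existence is an axiom of EMV-algebras below.\<close>

definition emv_compl :: "('a, 'b) emv_scheme \<Rightarrow> 'a \<Rightarrow> 'a \<Rightarrow> 'a \<Rightarrow> 'a" where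
  "emv_compl M a b x = (THE z. least (emv_order M) z (emv_compl_candidates M a b x))"

definition emv_interval_mv :: "('a, 'b) emv_scheme \<Rightarrow> 'a \<Rightarrow> 'a \<Rightarrow> 'a mv" where
  "emv_interval_mv M a b =
    \<lparr>carrier = emv_interval M a b, mv_plus = emv_plus M, mv_neg = emv_compl M a b,
     mv_zero = a, mv_one = b\<rparr>"

locale emv_algebra =
  fixes M :: "('a, 'b) emv_scheme" (structure)
  assumes join_closed: "\<lbrakk>x \<in> carrier M; y \<in> carrier M\<rbrakk> \<Longrightarrow> x \<^bold>\<or> y \<in> carrier M"
    and meet_closed: "\<lbrakk>x \<in> carrier M; y \<in> carrier M\<rbrakk> \<Longrightarrow> x \<^bold>\<and> y \<in> carrier M"
    and join_assoc: "\<lbrakk>x \<in> carrier M; y \<in> carrier M; z \<in> carrier M\<rbrakk>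
      \<Longrightarrow> (x \<^bold>\<or> y) \<^bold>\<or> z = x \<^bold>\<or> (y \<^bold>\<or> z)"
    and meet_assoc: "\<lbrakk>x \<in> carrier M; y \<in> carrier M; z \<in> carrier M\<rbrakk>
      \<Longrightarrow> (x \<^bold>\<and> y) \<^bold>\<and> z = x \<^bold>\<and> (y \<^bold>\<and> z)"
    and join_comm: "\<lbrakk>x \<in> carrier M; y \<in> carrier M\<rbrakk> \<Longrightarrow> x \<^bold>\<or> y = y \<^bold>\<or> x"
    and meet_comm: "\<lbrakk>x \<in> carrier M; y \<in> carrier M\<rbrakk> \<Longrightarrow> x \<^bold>\<and> y = y \<^bold>\<and> x"
    and join_absorb: "\<lbrakk>x \<in> carrier M; y \<in> carrier M\<rbrakk> \<Longrightarrow> x \<^bold>\<or> (x \<^bold>\<and> y) = x"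
    and meet_absorb: "\<lbrakk>x \<in> carrier M; y \<in> carrier M\<rbrakk> \<Longrightarrow> x \<^bold>\<and> (x \<^bold>\<or> y) = x"
    and meet_join_distrib: "\<lbrakk>x \<in> carrier M; y \<in> carrier M; z \<in> carrier M\<rbrakk>
      \<Longrightarrow> x \<^bold>\<and> (y \<^bold>\<or> z) = (x \<^bold>\<and> y) \<^bold>\<or> (x \<^bold>\<and> z)"
    and zero_least: "least (emv_order M) \<zero> (carrier M)"
    and comm_monoid: "comm_monoid \<lparr>carrier = carrier M, mult = (\<oplus>), one = \<zero>\<rparr>"
    and plus_mono: "\<lbrakk>x \<in> carrier M; y \<in> carrier M; z \<in> carrier M; x \<sqsubseteq>\<^bsub>emv_order M\<^esub> y\<rbrakk>
      \<Longrightarrow> x \<oplus> z \<sqsubseteq>\<^bsub>emv_order M\<^esub> y \<oplus> z"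
    and compl_exists: "\<lbrakk>a \<in> emv_idempotents M; b \<in> emv_idempotents M; a \<sqsubseteq>\<^bsub>emv_order M\<^esub> b;
        x \<in> emv_interval M a b\<rbrakk>
      \<Longrightarrow> \<exists>z. least (emv_order M) z (emv_compl_candidates M a b x)"
    and interval_mv: "\<lbrakk>a \<in> emv_idempotents M; b \<in> emv_idempotents M; a \<sqsubseteq>\<^bsub>emv_order M\<^esub> b\<rbrakk>
      \<Longrightarrow> mv_algebra (emv_interval_mv M a b)"
    and idempotent_above: "x \<in> carrier M \<Longrightarrow> \<exists>a \<in> emv_idempotents M. x \<sqsubseteq>\<^bsub>emv_order M\<^esub> a"

definition emv_ideal :: "('a, 'b) emv_scheme \<Rightarrow> 'a set \<Rightarrow> bool" where
  "emv_ideal M I \<longleftrightarrow>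
    I \<subseteq> carrier M \<and> I \<noteq> {} \<and>
    (\<forall>x \<in> carrier M. \<forall>y \<in> I. x \<sqsubseteq>\<^bsub>emv_order M\<^esub> y \<longrightarrow> x \<in> I) \<and>
    (\<forall>x \<in> I. \<forall>y \<in> I. x \<oplus>\<^bsub>M\<^esub> y \<in> I)"

definition emv_congruence :: "('a, 'b) emv_scheme \<Rightarrow> ('a \<times> 'a) set \<Rightarrow> bool" where
  "emv_congruence M \<theta> \<longleftrightarrow>
    equiv (carrier M) \<theta> \<and>
    compatible2 (emv_join M) \<theta> \<and> compatible2 (emv_meet M) \<theta> \<and> compatible2 (emv_plus M) \<theta> \<and>
    (\<forall>b \<in> emv_idempotents M.
      mv_congruence (emv_interval_mv M \<zero>\<^bsub>M\<^esub> b)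
        (\<theta> \<inter> (emv_interval M \<zero>\<^bsub>M\<^esub> b \<times> emv_interval M \<zero>\<^bsub>M\<^esub> b)))"

definition Ideal :: "('a, 'b) emv_scheme \<Rightarrow> 'a set gorder" where
  "Ideal M = \<lparr>carrier = {I. emv_ideal M I}, eq = (=), le = (\<subseteq>)\<rparr>"

definition Con :: "('a, 'b) emv_scheme \<Rightarrow> ('a \<times> 'a) set gorder" where
  "Con M = \<lparr>carrier = {\<theta>. emv_congruence M \<theta>}, eq = (=), le = (\<subseteq>)\<rparr>"

end

theory Submission
  imports Defs
begin

text \<open>
  Ideals: for ideals \<open>I\<close> and \<open>S\<close>, the set of all \<open>y\<close> such that \<open>x \<and> y \<in> S\<close> for every \<open>x \<in> I\<close> is
  again an ideal, because \<open>x \<and> (y \<oplus> z) \<le> (x \<and> y) \<oplus> (x \<and> z)\<close>. It is the Heyting implication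
  from \<open>I\<close> to \<open>S\<close>, and a complete lattice with such implications is Brouwer.

  Congruences: the join of two congruences is the transitive closure of their union. The only
  delicate point is the compatibility with the complements \<open>\<lambda>\<^sub>b\<close>, and for it one intersects a
  connecting chain with \<open>b\<close>. Distributivity then follows from the lattice operations alone: the
  median term \<open>m x y z = (x \<and> y) \<or> (z \<and> (x \<or> y))\<close> satisfies \<open>m x y x = x\<close>, \<open>m x y y = y\<close> and
  \<open>m x x z = x\<close>, so that applying \<open>m x y\<close> to a chain from \<open>x\<close> to \<open>y\<close> in \<open>\<beta> \<union> \<gamma>\<close>, where
  \<open>(x, y) \<in> \<alpha>\<close>, moves the whole chain into one class of \<open>\<alpha>\<close>.
\<close>

section \<open>Families of sets ordered by inclusion\<close>

text \<open>\<open>Ideal M\<close> and \<open>Con M\<close> both unfold to orders of this shape, so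
  meets, joins and completeness are settled once for arbitrary families of sets.\<close>

abbreviation subset_order :: "'a set set \<Rightarrow> 'a set gorder" where
  "subset_order F \<equiv> \<lparr>carrier = F, eq = (=), le = (\<subseteq>)\<rparr>"

lemma partial_order_subset_order: "partial_order (subset_order F)"
  by unfold_locales auto

text \<open>The extra \<open>X \<in> F\<close> in the last premise mirrors \<open>Upper\<close>,
  which tests only those members of \<open>A\<close> that lie in the carrier.\<close>

lemma least_Upper_subset_orderI:
  assumes "s \<in> F" "\<And>X. X \<in> A \<Longrightarrow> X \<subseteq> s"
    and "\<And>T. \<lbrakk>T \<in> F; \<And>X. X \<in> A \<Longrightarrow> X \<in> F \<Longrightarrow> X \<subseteq> T\<rbrakk> \<Longrightarrow> s \<subseteq> T"
  shows "least (subset_order F) s (Upper (subset_order F) A)"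
  using assms by (auto simp: least_def Upper_def)

lemma greatest_Lower_Inter:
  assumes "\<Inter>A \<in> F" "A \<subseteq> F"
  shows "greatest (subset_order F) (\<Inter>A) (Lower (subset_order F) A)"
  using assms by (auto simp: greatest_def Lower_def)

lemma meet_subset_order:
  assumes "X \<in> F" "Y \<in> F" "X \<inter> Y \<in> F"
  shows "X \<sqinter>\<^bsub>subset_order F\<^esub> Y = X \<inter> Y"
proof -
  interpret partial_order "subset_order F" by (rule partial_order_subset_order)
  have "greatest (subset_order F) (X \<inter> Y) (Lower (subset_order F) {X, Y})"
    using greatest_Lower_Inter[of "{X, Y}" F] assms by simp
  \<comment> \<open>\<open>inf\<close> is a \<open>SOME\<close> choice of a greatest lower bound;
    uniqueness of greatest elements identifies the choice with the intersection.\<close>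
  then show ?thesis
    unfolding meet_def inf_def
    by (rule some_equality) (rule greatest_unique[OF _ \<open>greatest _ _ _\<close>])
qed

lemma join_subset_order:
  assumes "S \<in> F" "X \<subseteq> S" "Y \<subseteq> S" "X \<in> F" "Y \<in> F"
    and "\<And>T. \<lbrakk>T \<in> F; X \<subseteq> T; Y \<subseteq> T\<rbrakk> \<Longrightarrow> S \<subseteq> T"
  shows "X \<squnion>\<^bsub>subset_order F\<^esub> Y = S"
proof -
  interpret partial_order "subset_order F" by (rule partial_order_subset_order)
  have "least (subset_order F) S (Upper (subset_order F) {X, Y})"
    using assms by (intro least_Upper_subset_orderI) auto
  then show ?thesis
    unfolding join_def sup_def
    by (rule some_equality) (rule least_unique[OF _ \<open>least _ _ _\<close>])
qed

text \<open>Joins arise as intersections of the upper bounds, and the top \<open>U\<close>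
  guarantees that upper bounds exist. The empty family is handled by \<open>U\<close>, since
  \<open>\<Inter>{}\<close> is the whole type and need not belong to \<open>F\<close>.\<close>

lemma complete_lattice_subset_order:
  assumes "U \<in> F" "\<And>X. X \<in> F \<Longrightarrow> X \<subseteq> U"
    and "\<And>A. \<lbrakk>A \<subseteq> F; A \<noteq> {}\<rbrakk> \<Longrightarrow> \<Inter>A \<in> F"
  shows "complete_lattice (subset_order F)"
proof (rule partial_order.complete_lattice_criterion1[OF partial_order_subset_order])
  show "\<exists>g. greatest (subset_order F) g (carrier (subset_order F))"
    using assms(1,2) by (auto simp: greatest_def)
next
  fix A assume "A \<subseteq> carrier (subset_order F)" "A \<noteq> {}"
  then show "\<exists>i. greatest (subset_order F) i (Lower (subset_order F) A)"
    using assms(3)[of A] greatest_Lower_Inter[of A F] by auto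
qed

text \<open>Premise \<open>imp\<close> gives \<open>\<lambda>Y. X \<inter> Y\<close> a right
  adjoint, and a left adjoint preserves all joins.\<close>

lemma complete_Brouwer_lattice_subset_orderI:
  assumes "complete_lattice (subset_order F)"
    and Int: "\<And>X Y. \<lbrakk>X \<in> F; Y \<in> F\<rbrakk> \<Longrightarrow> X \<inter> Y \<in> F"
    and imp: "\<And>X S. \<lbrakk>X \<in> F; S \<in> F\<rbrakk>
      \<Longrightarrow> \<exists>K \<in> F. \<forall>Y \<in> F. Y \<subseteq> K \<longleftrightarrow> X \<inter> Y \<subseteq> S"
  shows "complete_Brouwer_lattice (subset_order F)"
proof -
  interpret complete_lattice "subset_order F" by fact
  have meet: "X \<sqinter>\<^bsub>subset_order F\<^esub> Y = X \<inter> Y" if "X \<in> F" "Y \<in> F" for X Y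
    using that Int meet_subset_order by blast
  show ?thesis
  proof
    fix X A assume "X \<in> carrier (subset_order F)" "A \<subseteq> carrier (subset_order F)"
    then have X: "X \<in> F" and A: "A \<subseteq> F" by auto
    let ?S = "\<Squnion>\<^bsub>subset_order F\<^esub>((\<lambda>Y. X \<sqinter>\<^bsub>subset_order F\<^esub> Y) ` A)"
    let ?A = "\<Squnion>\<^bsub>subset_order F\<^esub>A"
    have image: "(\<lambda>Y. X \<sqinter>\<^bsub>subset_order F\<^esub> Y) ` A \<subseteq> F"
      using X A meet Int by auto
    then have S: "?S \<in> F" using sup_closed by simp
    have supA: "?A \<in> F" using A sup_closed by simp
    have upperA: "Y \<subseteq> ?A" if "Y \<in> A" for Y using sup_upper[of A Y] A that by simp
    have image_eq: "(\<lambda>Y. X \<sqinter>\<^bsub>subset_order F\<^esub> Y) ` A = (\<lambda>Y. X \<inter> Y) ` A"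
      using X A meet by (intro image_cong) auto
    have upperS: "X \<inter> Y \<subseteq> ?S" if "Y \<in> A" for Y
    proof -
      have "X \<inter> Y \<in> (\<lambda>Y. X \<sqinter>\<^bsub>subset_order F\<^esub> Y) ` A"
        unfolding image_eq using that by blast
      then show ?thesis
        using sup_upper[of "(\<lambda>Y. X \<sqinter>\<^bsub>subset_order F\<^esub> Y) ` A" "X \<inter> Y"] image by simp
    qed
    \<comment> \<open>The implication from \<open>X\<close> to the join of the meets: it contains
      every member of \<open>A\<close>, hence their join \<open>?A\<close>, and the adjunction turns
      this into the nontrivial inclusion.\<close>
    obtain K where K: "K \<in> F" "\<And>Y. Y \<in> F \<Longrightarrow> Y \<subseteq> K \<longleftrightarrow> X \<inter> Y \<subseteq> ?S"
      using imp[OF X S] by blast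
    have "?A \<subseteq> K"
      using sup_least[of A K] A K upperS by auto
    then have "X \<inter> ?A \<subseteq> ?S" using K supA by blast
    moreover have "?S \<subseteq> X \<inter> ?A"
      using sup_least[of "(\<lambda>Y. X \<sqinter>\<^bsub>subset_order F\<^esub> Y) ` A" "X \<inter> ?A"]
        image Int[OF X supA] upperA unfolding image_eq by auto
    ultimately show "X \<sqinter>\<^bsub>subset_order F\<^esub> ?A = ?S"
      using meet X supA by auto
  qed
qed

section \<open>Order and complements in EMV-algebras\<close>

context emv_algebra
begin

abbreviation below (infix \<open>\<preceq>\<close> 50) where
  "x \<preceq> y \<equiv> x \<sqsubseteq>\<^bsub>emv_order M\<^esub> y"

section \<open>The lattice order and the monoid laws\<close>

lemma below_iff: "x \<preceq> y \<longleftrightarrow> x \<^bold>\<and> y = x"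
  by (simp add: emv_order_def)

lemma carrier_emv_order [simp]: "carrier (emv_order M) = carrier M"
  by (simp add: emv_order_def)

lemma meet_idem: "x \<in> carrier M \<Longrightarrow> x \<^bold>\<and> x = x"
  using join_absorb[of x x] meet_absorb[of x "x \<^bold>\<and> x"] meet_closed[of x x] by simp

lemma join_idem: "x \<in> carrier M \<Longrightarrow> x \<^bold>\<or> x = x"
  using join_absorb[of x x] meet_idem[of x] by simp

lemma below_antisym: "\<lbrakk>x \<preceq> y; y \<preceq> x; x \<in> carrier M; y \<in> carrier M\<rbrakk> \<Longrightarrow> x = y"
  using meet_comm by (auto simp: below_iff)

lemma below_trans:
  "\<lbrakk>x \<preceq> y; y \<preceq> z; x \<in> carrier M; y \<in> carrier M; z \<in> carrier M\<rbrakk> \<Longrightarrow> x \<preceq> z"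
  unfolding below_iff using meet_assoc by metis

lemma meet_below1: "\<lbrakk>x \<in> carrier M; y \<in> carrier M\<rbrakk> \<Longrightarrow> x \<^bold>\<and> y \<preceq> x"
  unfolding below_iff using meet_assoc meet_comm meet_idem meet_closed by metis

lemma meet_below2: "\<lbrakk>x \<in> carrier M; y \<in> carrier M\<rbrakk> \<Longrightarrow> x \<^bold>\<and> y \<preceq> y"
  unfolding below_iff using meet_assoc meet_idem by metis

lemma below_meetI:
  "\<lbrakk>z \<preceq> x; z \<preceq> y; x \<in> carrier M; y \<in> carrier M; z \<in> carrier M\<rbrakk> \<Longrightarrow> z \<preceq> x \<^bold>\<and> y"
  unfolding below_iff using meet_assoc by metis

lemma below_join1: "\<lbrakk>x \<in> carrier M; y \<in> carrier M\<rbrakk> \<Longrightarrow> x \<preceq> x \<^bold>\<or> y"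
  by (simp add: below_iff meet_absorb)

lemma below_join2: "\<lbrakk>x \<in> carrier M; y \<in> carrier M\<rbrakk> \<Longrightarrow> y \<preceq> x \<^bold>\<or> y"
  using below_join1 join_comm by metis

lemma zero_closed: "\<zero> \<in> carrier M"
  using zero_least by (simp add: least_def)

lemma zero_below: "x \<in> carrier M \<Longrightarrow> \<zero> \<preceq> x"
  using zero_least by (simp add: least_def)

lemma plus_closed: "\<lbrakk>x \<in> carrier M; y \<in> carrier M\<rbrakk> \<Longrightarrow> x \<oplus> y \<in> carrier M"
  using monoid.m_closed[OF comm_monoid.axioms(1)[OF comm_monoid]] by simp

lemma plus_assoc:
  "\<lbrakk>x \<in> carrier M; y \<in> carrier M; z \<in> carrier M\<rbrakk> \<Longrightarrow> x \<oplus> y \<oplus> z = x \<oplus> (y \<oplus> z)"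
  using monoid.m_assoc[OF comm_monoid.axioms(1)[OF comm_monoid]] by simp

lemma plus_comm: "\<lbrakk>x \<in> carrier M; y \<in> carrier M\<rbrakk> \<Longrightarrow> x \<oplus> y = y \<oplus> x"
  using comm_monoid.m_comm[OF comm_monoid] by simp

lemma zero_plus: "x \<in> carrier M \<Longrightarrow> \<zero> \<oplus> x = x"
  using monoid.l_one[OF comm_monoid.axioms(1)[OF comm_monoid]] by simp

section \<open>The interval [0, b] below an idempotent b and its complement\<close>

lemma idempotent_closed: "b \<in> emv_idempotents M \<Longrightarrow> b \<in> carrier M"
  by (simp add: emv_idempotents_def)

lemma zero_idempotent: "\<zero> \<in> emv_idempotents M"
  by (simp add: emv_idempotents_def zero_closed zero_plus)

lemma interval_zero: "x \<in> emv_interval M \<zero> b \<longleftrightarrow> x \<in> carrier M \<and> x \<preceq> b"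
  unfolding emv_interval_def at_least_at_most_def using zero_below by auto

lemma plus_below_idempotent:
  assumes "b \<in> emv_idempotents M" "x \<in> carrier M" "y \<in> carrier M" "x \<preceq> b" "y \<preceq> b"
  shows "x \<oplus> y \<preceq> b"
proof -
  have b: "b \<in> carrier M" "b \<oplus> b = b" using assms(1) by (auto simp: emv_idempotents_def)
  have "x \<oplus> y \<preceq> b \<oplus> y" using plus_mono assms b by blast
  moreover have "b \<oplus> y \<preceq> b \<oplus> b"
    using plus_mono[of y b b] assms b plus_comm by metis
  ultimately show ?thesis
    using below_trans plus_closed assms b by metis
qed

text \<open>Antisymmetry makes the minimum unique, so the description operator in
  \<open>emv_compl\<close> denotes it; the first four facts just say that it is the least candidate.
  The involution law is the one taken from the MV-algebra [0, b].\<close>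

lemma
  assumes b: "b \<in> emv_idempotents M" and x: "x \<in> carrier M" "x \<preceq> b"
  shows compl_closed: "emv_compl M \<zero> b x \<in> carrier M"
    and compl_below: "emv_compl M \<zero> b x \<preceq> b"
    and plus_compl: "x \<oplus> emv_compl M \<zero> b x = b"
    and compl_least: "\<And>z. \<lbrakk>z \<in> carrier M; z \<preceq> b; x \<oplus> z = b\<rbrakk> \<Longrightarrow> emv_compl M \<zero> b x \<preceq> z"
    and compl_compl: "emv_compl M \<zero> b (emv_compl M \<zero> b x) = x"
proof -
  have zb: "\<zero> \<preceq> b" using zero_below idempotent_closed b by blast
  have xi: "x \<in> emv_interval M \<zero> b" using x interval_zero by blast
  obtain z where z: "least (emv_order M) z (emv_compl_candidates M \<zero> b x)"
    using compl_exists[OF zero_idempotent b zb xi] by blast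
  have "emv_compl M \<zero> b x = z"
    unfolding emv_compl_def
  proof (rule the_equality)
    show "least (emv_order M) z (emv_compl_candidates M \<zero> b x)" by (fact z)
    fix z' assume "least (emv_order M) z' (emv_compl_candidates M \<zero> b x)"
    with z show "z' = z" by (auto simp: least_def intro!: below_antisym)
  qed
  with z have *: "least (emv_order M) (emv_compl M \<zero> b x) (emv_compl_candidates M \<zero> b x)"
    by simp
  then show "emv_compl M \<zero> b x \<in> carrier M" "emv_compl M \<zero> b x \<preceq> b"
    "x \<oplus> emv_compl M \<zero> b x = b"
    by (auto simp: least_def emv_compl_candidates_def interval_zero)
  show "emv_compl M \<zero> b x \<preceq> z" if "z \<in> carrier M" "z \<preceq> b" "x \<oplus> z = b" for z
    using * that by (auto simp: least_def emv_compl_candidates_def interval_zero)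
  show "emv_compl M \<zero> b (emv_compl M \<zero> b x) = x"
    using mv_algebra.neg_neg[OF interval_mv[OF zero_idempotent b zb]] xi
    by (simp add: emv_interval_mv_def)
qed

section \<open>Residuation in [0, b] and distributivity of sums over meets\<close>

lemma below_iff_compl_plus:
  assumes b: "b \<in> emv_idempotents M"
    and x: "x \<in> carrier M" "x \<preceq> b" and y: "y \<in> carrier M" "y \<preceq> b"
  shows "x \<preceq> y \<longleftrightarrow> emv_compl M \<zero> b x \<oplus> y = b"
proof
  note c = compl_closed[OF b x] compl_below[OF b x]
  assume "x \<preceq> y"
  then have "b \<preceq> y \<oplus> emv_compl M \<zero> b x"
    using plus_mono[OF x(1) y(1) c(1)] plus_compl[OF b x] by simp
  then show "emv_compl M \<zero> b x \<oplus> y = b"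
    using below_antisym plus_below_idempotent[OF b c(1) y(1) c(2) y(2)]
      plus_comm[OF c(1) y(1)] plus_closed[OF c(1) y(1)] idempotent_closed[OF b] by metis
next
  note c = compl_closed[OF b x] compl_below[OF b x]
  assume "emv_compl M \<zero> b x \<oplus> y = b"
  \<comment> \<open>The equation makes \<open>y\<close> a candidate for the complement of the
    complement of \<open>x\<close>; by involution the least such candidate is \<open>x\<close>
    itself.\<close>
  then show "x \<preceq> y"
    using compl_least[OF b c y] compl_compl[OF b x] by simp
qed

text \<open>By \<open>below_iff_compl_plus\<close> both sides express that the complement of
  \<open>w\<close>, \<open>x\<close> and \<open>y\<close> sum to \<open>b\<close>. The left-hand
  term of the second inequality is the MV difference of \<open>w\<close> and \<open>x\<close>, so
  adding \<open>x\<close> has a left adjoint.\<close>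

lemma residuation:
  assumes b: "b \<in> emv_idempotents M" and w: "w \<in> carrier M" "w \<preceq> b"
    and x: "x \<in> carrier M" "x \<preceq> b" and y: "y \<in> carrier M" "y \<preceq> b"
  shows "w \<preceq> x \<oplus> y \<longleftrightarrow> emv_compl M \<zero> b (emv_compl M \<zero> b w \<oplus> x) \<preceq> y"
proof -
  note c = compl_closed[OF b w] compl_below[OF b w]
  note d = plus_closed[OF c(1) x(1)] plus_below_idempotent[OF b c(1) x(1) c(2) x(2)]
  note s = plus_closed[OF x(1) y(1)] plus_below_idempotent[OF b x(1) y(1) x(2) y(2)]
  show ?thesis
    using below_iff_compl_plus[OF b w s]
      below_iff_compl_plus[OF b compl_closed[OF b d] compl_below[OF b d] y]
      compl_compl[OF b d] plus_assoc[OF c(1) x(1) y(1)] by simp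
qed

text \<open>Adding \<open>x\<close> is a right adjoint on an interval [0, b] and therefore preserves
  binary meets.\<close>

lemma below_plus_meet:
  assumes w: "w \<in> carrier M" and x: "x \<in> carrier M"
    and y: "y \<in> carrier M" and z: "z \<in> carrier M"
    and wy: "w \<preceq> x \<oplus> y" and wz: "w \<preceq> x \<oplus> z"
  shows "w \<preceq> x \<oplus> (y \<^bold>\<and> z)"
proof -
  \<comment> \<open>An idempotent above this join bounds all four elements at once, so that a single
    MV-algebra [0, b] suffices.\<close>
  let ?u = "(w \<^bold>\<or> x) \<^bold>\<or> (y \<^bold>\<or> z)"
  have u: "?u \<in> carrier M" using assms join_closed by simp
  obtain b where b: "b \<in> emv_idempotents M" "?u \<preceq> b" using idempotent_above[OF u] by blast
  note bc = idempotent_closed[OF b(1)]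
  have ub: "v \<preceq> b" if "v \<preceq> s" "s \<preceq> ?u" "v \<in> carrier M" "s \<in> carrier M" for v s
    using below_trans that b u bc by blast
  have wb: "w \<preceq> b" and xb: "x \<preceq> b"
    using ub[of _ "w \<^bold>\<or> x"] w x y z join_closed below_join1 below_join2 by simp_all
  have yb: "y \<preceq> b" and zb: "z \<preceq> b"
    using ub[of _ "y \<^bold>\<or> z"] w x y z join_closed below_join1 below_join2 by simp_all
  have yz: "y \<^bold>\<and> z \<in> carrier M" "y \<^bold>\<and> z \<preceq> b"
    using meet_closed y z below_trans[OF meet_below1 yb] bc by auto
  let ?d = "emv_compl M \<zero> b w \<oplus> x"
  note c = compl_closed[OF b(1) w wb] compl_below[OF b(1) w wb]
  note d = plus_closed[OF c(1) x] plus_below_idempotent[OF b(1) c(1) x c(2) xb]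
  have "emv_compl M \<zero> b ?d \<preceq> y" "emv_compl M \<zero> b ?d \<preceq> z"
    using residuation[OF b(1) w wb x xb y yb] residuation[OF b(1) w wb x xb z zb] wy wz
    by auto
  then have "emv_compl M \<zero> b ?d \<preceq> y \<^bold>\<and> z"
    using below_meetI y z compl_closed[OF b(1) d] by blast
  then show ?thesis using residuation[OF b(1) w wb x xb yz] by blast
qed

lemma below_plus:
  assumes "x \<in> carrier M" "y \<in> carrier M"
  shows "x \<preceq> x \<oplus> y"
  using plus_mono[of \<zero> y x] zero_below assms zero_closed zero_plus plus_comm by simp

text \<open>Distributing sums over meets, the right side is bounded below by whatever lies below x
  \<oplus> x, x \<oplus> z, y \<oplus> x and y \<oplus> z. The left side lies below y \<oplus> z,
  and below x, hence below every sum with x as a summand.\<close>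

lemma meet_plus_below:
  assumes x: "x \<in> carrier M" and y: "y \<in> carrier M" and z: "z \<in> carrier M"
  shows "x \<^bold>\<and> (y \<oplus> z) \<preceq> (x \<^bold>\<and> y) \<oplus> (x \<^bold>\<and> z)"
proof -
  let ?w = "x \<^bold>\<and> (y \<oplus> z)"
  have yz: "y \<oplus> z \<in> carrier M" using plus_closed y z .
  have w: "?w \<in> carrier M" using meet_closed x yz .
  have xy: "x \<^bold>\<and> y \<in> carrier M" using meet_closed x y .
  have wx: "?w \<preceq> x" and wyz: "?w \<preceq> y \<oplus> z"
    using meet_below1[OF x yz] meet_below2[OF x yz] by auto
  have bx: "?w \<preceq> x \<oplus> v" if "v \<in> carrier M" for v
    using below_trans[OF wx below_plus[OF x that] w x plus_closed[OF x that]] .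
  have "?w \<preceq> z \<oplus> (x \<^bold>\<and> y)"
    using below_plus_meet[OF w z x y] bx[OF z] wyz plus_comm x y z by simp
  moreover have "?w \<preceq> x \<oplus> (x \<^bold>\<and> y)" using bx[OF xy] .
  ultimately show ?thesis
    using below_plus_meet[OF w xy x z] plus_comm[OF xy x] plus_comm[OF xy z] by simp
qed

section \<open>Ideals\<close>

lemma emv_idealD:
  assumes "emv_ideal M I"
  shows "I \<subseteq> carrier M" and "\<And>x y. \<lbrakk>y \<in> I; x \<in> carrier M; x \<preceq> y\<rbrakk> \<Longrightarrow> x \<in> I"
    and "\<And>x y. \<lbrakk>x \<in> I; y \<in> I\<rbrakk> \<Longrightarrow> x \<oplus> y \<in> I" and "\<zero> \<in> I"
  using assms zero_closed zero_below unfolding emv_ideal_def by blast+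

lemma emv_ideal_carrier: "emv_ideal M (carrier M)"
  unfolding emv_ideal_def using zero_closed plus_closed by blast

lemma emv_ideal_Inter:
  assumes "A \<noteq> {}" "\<And>I. I \<in> A \<Longrightarrow> emv_ideal M I"
  shows "emv_ideal M (\<Inter>A)"
  unfolding emv_ideal_def
proof (intro conjI)
  show "\<Inter>A \<subseteq> carrier M" using assms emv_idealD(1) by blast
  show "\<Inter>A \<noteq> {}" using assms emv_idealD(4) by blast
  show "\<forall>x\<in>carrier M. \<forall>y\<in>\<Inter>A. x \<preceq> y \<longrightarrow> x \<in> \<Inter>A" using assms emv_idealD(2) by blast
  show "\<forall>x\<in>\<Inter>A. \<forall>y\<in>\<Inter>A. x \<oplus> y \<in> \<Inter>A" using assms emv_idealD(3) by blast
qed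

lemma emv_ideal_implication:
  assumes I: "emv_ideal M I" and S: "emv_ideal M S"
  shows "emv_ideal M {y \<in> carrier M. \<forall>x\<in>I. x \<^bold>\<and> y \<in> S}" (is "emv_ideal M ?K")
  unfolding emv_ideal_def
proof (intro conjI ballI impI)
  show "?K \<subseteq> carrier M" by blast
  have "x \<^bold>\<and> \<zero> = \<zero>" if "x \<in> I" for x
    using that emv_idealD(1)[OF I] zero_below[of x] zero_closed meet_comm below_iff by auto
  then have "\<zero> \<in> ?K" using zero_closed emv_idealD(4)[OF S] by auto
  then show "?K \<noteq> {}" by blast
next
  fix v y assume v: "v \<in> carrier M" and y: "y \<in> ?K" and vy: "v \<preceq> y"
  have "x \<^bold>\<and> v \<in> S" if "x \<in> I" for x
  proof (rule emv_idealD(2)[OF S])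
    have x: "x \<in> carrier M" using that emv_idealD(1)[OF I] by blast
    show "x \<^bold>\<and> y \<in> S" using y that by blast
    show "x \<^bold>\<and> v \<in> carrier M" using x v meet_closed by blast
    show "x \<^bold>\<and> v \<preceq> x \<^bold>\<and> y"
      using below_meetI meet_below1[OF x v] below_trans[OF meet_below2[OF x v] vy]
        x v y meet_closed by blast
  qed
  then show "v \<in> ?K" using v by blast
next
  fix y z assume y: "y \<in> ?K" and z: "z \<in> ?K"
  have "x \<^bold>\<and> (y \<oplus> z) \<in> S" if "x \<in> I" for x
  proof (rule emv_idealD(2)[OF S])
    have x: "x \<in> carrier M" using that emv_idealD(1)[OF I] by blast
    show "(x \<^bold>\<and> y) \<oplus> (x \<^bold>\<and> z) \<in> S" using y z that emv_idealD(3)[OF S] by blast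
    show "x \<^bold>\<and> (y \<oplus> z) \<in> carrier M" using x y z meet_closed plus_closed by blast
    show "x \<^bold>\<and> (y \<oplus> z) \<preceq> (x \<^bold>\<and> y) \<oplus> (x \<^bold>\<and> z)"
      using meet_plus_below x y z by blast
  qed
  then show "y \<oplus> z \<in> ?K" using y z plus_closed by blast
qed

lemma Ideal_complete_Brouwer_lattice: "complete_Brouwer_lattice (Ideal M)"
  unfolding Ideal_def
proof (rule complete_Brouwer_lattice_subset_orderI)
  show "complete_lattice (subset_order {I. emv_ideal M I})"
    using emv_ideal_carrier emv_idealD(1) emv_ideal_Inter
    by (intro complete_lattice_subset_order[of "carrier M"]) auto
next
  fix I J assume "I \<in> {I. emv_ideal M I}" "J \<in> {I. emv_ideal M I}"
  then show "I \<inter> J \<in> {I. emv_ideal M I}" using emv_ideal_Inter[of "{I, J}"] by auto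
next
  fix I S assume "I \<in> {I. emv_ideal M I}" "S \<in> {I. emv_ideal M I}"
  then have I: "emv_ideal M I" and S: "emv_ideal M S" by auto
  let ?K = "{y \<in> carrier M. \<forall>x\<in>I. x \<^bold>\<and> y \<in> S}"
  have "J \<subseteq> ?K \<longleftrightarrow> I \<inter> J \<subseteq> S" if J: "emv_ideal M J" for J
  proof
    assume "J \<subseteq> ?K"
    \<comment> \<open>An element of both ideals is tested against itself.\<close>
    then have "x \<^bold>\<and> x \<in> S" if "x \<in> I \<inter> J" for x using that by blast
    then show "I \<inter> J \<subseteq> S" using meet_idem emv_idealD(1)[OF I] by fastforce
  next
    assume IJ: "I \<inter> J \<subseteq> S"
    have "x \<^bold>\<and> y \<in> S" if x: "x \<in> I" and y: "y \<in> J" for x y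
    proof -
      have c: "x \<in> carrier M" "y \<in> carrier M"
        using x y emv_idealD(1)[OF I] emv_idealD(1)[OF J] by auto
      \<comment> \<open>The meet lies below an element of each ideal, so down-closure puts it into
        both.\<close>
      have "x \<^bold>\<and> y \<in> I" "x \<^bold>\<and> y \<in> J"
        using emv_idealD(2)[OF I x meet_closed[OF c] meet_below1[OF c]]
          emv_idealD(2)[OF J y meet_closed[OF c] meet_below2[OF c]] by auto
      then show ?thesis using IJ by blast
    qed
    then show "J \<subseteq> ?K" using emv_idealD(1)[OF J] by blast
  qed
  then show "\<exists>K \<in> {I. emv_ideal M I}. \<forall>J \<in> {I. emv_ideal M I}. J \<subseteq> K \<longleftrightarrow> I \<inter> J \<subseteq> S"
    using emv_ideal_implication[OF I S] by (intro bexI[of _ ?K]) simp_all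
qed

end

section \<open>Congruences\<close>

text \<open>A map sending links to links sends chains to chains. It is applied below to translations
  of a binary operation, to complements of meets with \<open>b\<close>, and to the median
  term.\<close>

lemma trancl_map_step:
  assumes "(x, y) \<in> r\<^sup>+" "\<And>u v. (u, v) \<in> r \<Longrightarrow> (f u, f v) \<in> s"
  shows "(f x, f y) \<in> s\<^sup>+"
  using assms(1) by induction (auto intro: assms(2) trancl_into_trancl)

section \<open>Equivalence relations and transitive closures of their unions\<close>

lemma equivD:
  assumes "equiv C \<theta>"
  shows "\<theta> \<subseteq> C \<times> C" and "\<And>x. x \<in> C \<Longrightarrow> (x, x) \<in> \<theta>"
    and "\<And>x y. (x, y) \<in> \<theta> \<Longrightarrow> (y, x) \<in> \<theta>"
    and "\<And>x y z. (x, y) \<in> \<theta> \<Longrightarrow> (y, z) \<in> \<theta> \<Longrightarrow> (x, z) \<in> \<theta>"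
  using assms by (auto simp: equiv_def refl_on_def dest: symD transD)

lemma equiv_Int:
  assumes "equiv C \<theta>" "equiv C \<phi>"
  shows "equiv C (\<theta> \<inter> \<phi>)"
proof (rule equivI)
  show "\<theta> \<inter> \<phi> \<subseteq> C \<times> C" using equivD(1)[OF assms(1)] by blast
  show "refl_on C (\<theta> \<inter> \<phi>)" using equivD(2)[OF assms(1)] equivD(2)[OF assms(2)] by (auto simp: refl_on_def)
  show "sym (\<theta> \<inter> \<phi>)" using assms by (simp add: equiv_def sym_Int)
  show "trans (\<theta> \<inter> \<phi>)" using assms by (simp add: equiv_def trans_Int)
qed

lemma equiv_Int_square:
  assumes "equiv C \<theta>" "J \<subseteq> C"
  shows "equiv J (\<theta> \<inter> (J \<times> J))"
proof (rule equivI)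
  show "refl_on J (\<theta> \<inter> (J \<times> J))" using equivD(2)[OF assms(1)] assms(2)
    by (auto simp: refl_on_def)
  show "sym (\<theta> \<inter> (J \<times> J))" using assms(1) by (auto simp: equiv_def sym_def)
  show "trans (\<theta> \<inter> (J \<times> J))"
    using assms(1) by (intro trans_Int) (auto simp: equiv_def trans_def)
qed blast

text \<open>The closure is \<open>\<^sup>+\<close> and not \<open>\<^sup>*\<close>: reflexivity on
  \<open>C\<close> is supplied by \<theta>, while \<open>\<^sup>*\<close> would also relate elements
  outside \<open>C\<close> to themselves.\<close>

lemma equiv_trancl_Un:
  assumes "equiv C \<theta>" "equiv C \<phi>"
  shows "equiv C ((\<theta> \<union> \<phi>)\<^sup>+)"
proof (rule equivI)
  show "(\<theta> \<union> \<phi>)\<^sup>+ \<subseteq> C \<times> C"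
    using trancl_subset_Sigma[of "\<theta> \<union> \<phi>" C] equivD(1) assms by blast
  show "refl_on C ((\<theta> \<union> \<phi>)\<^sup>+)"
    using equivD(2)[OF assms(1)] by (auto simp: refl_on_def)
  show "sym ((\<theta> \<union> \<phi>)\<^sup>+)"
    using assms by (auto intro!: sym_trancl sym_Un simp: equiv_def)
qed simp

lemma compatible2D:
  "\<lbrakk>compatible2 f \<theta>; (x, x') \<in> \<theta>; (y, y') \<in> \<theta>\<rbrakk> \<Longrightarrow> (f x y, f x' y') \<in> \<theta>"
  by (auto simp: compatible2_def)

lemma compatible2_Int:
  "\<lbrakk>compatible2 f \<theta>; compatible2 f \<phi>\<rbrakk> \<Longrightarrow> compatible2 f (\<theta> \<inter> \<phi>)"
  by (simp add: compatible2_def)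

text \<open>The two chains may differ in length, so one argument is moved at a time, from
  \<open>f x y\<close> through \<open>f x' y\<close> to \<open>f x' y'\<close>. The argument held
  fixed is related to itself by reflexivity of both relations.\<close>

lemma compatible2_trancl_Un:
  assumes eq: "equiv C \<theta>" "equiv C \<phi>"
    and comp: "compatible2 f \<theta>" "compatible2 f \<phi>"
  shows "compatible2 f ((\<theta> \<union> \<phi>)\<^sup>+)"
  unfolding compatible2_def
proof (intro allI impI)
  fix x x' y y'
  assume x: "(x, x') \<in> (\<theta> \<union> \<phi>)\<^sup>+" and y: "(y, y') \<in> (\<theta> \<union> \<phi>)\<^sup>+"
  have C: "x' \<in> C" "y \<in> C" using x y equivD(1)[OF equiv_trancl_Un[OF eq]] by auto
  have "(f x y, f x' y) \<in> (\<theta> \<union> \<phi>)\<^sup>+"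
    using compatible2D[OF comp(1) _ equivD(2)[OF eq(1) C(2)]]
      compatible2D[OF comp(2) _ equivD(2)[OF eq(2) C(2)]]
    by (intro trancl_map_step[OF x, where f = "\<lambda>u. f u y"]) auto
  moreover have "(f x' y, f x' y') \<in> (\<theta> \<union> \<phi>)\<^sup>+"
    using compatible2D[OF comp(1) equivD(2)[OF eq(1) C(1)]]
      compatible2D[OF comp(2) equivD(2)[OF eq(2) C(1)]]
    by (intro trancl_map_step[OF y, where f = "f x'"]) auto
  ultimately show "(f x y, f x' y') \<in> (\<theta> \<union> \<phi>)\<^sup>+" by (rule trancl_trans)
qed

context emv_algebra
begin

text \<open>On [0, b] the equivalence property and compatibility with \<oplus> are inherited from
  \<theta>, because [0, b] is closed under \<oplus>. Only the complement clause adds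
  information.\<close>

lemma emv_congruence_iff:
  "emv_congruence M \<theta> \<longleftrightarrow>
    equiv (carrier M) \<theta> \<and>
    compatible2 (emv_join M) \<theta> \<and> compatible2 (emv_meet M) \<theta> \<and> compatible2 (emv_plus M) \<theta> \<and>
    (\<forall>b \<in> emv_idempotents M. \<forall>x y. (x, y) \<in> \<theta> \<longrightarrow> x \<preceq> b \<longrightarrow> y \<preceq> b \<longrightarrow>
      (emv_compl M \<zero> b x, emv_compl M \<zero> b y) \<in> \<theta>)"
proof -
  have "mv_congruence (emv_interval_mv M \<zero> b)
      (\<theta> \<inter> (emv_interval M \<zero> b \<times> emv_interval M \<zero> b)) \<longleftrightarrow>
    (\<forall>x y. (x, y) \<in> \<theta> \<longrightarrow> x \<preceq> b \<longrightarrow> y \<preceq> b \<longrightarrow>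
      (emv_compl M \<zero> b x, emv_compl M \<zero> b y) \<in> \<theta>)"
    (is "?L \<longleftrightarrow> ?R")
    if eq: "equiv (carrier M) \<theta>" and plus: "compatible2 (emv_plus M) \<theta>"
      and b: "b \<in> emv_idempotents M" for b
  proof
    assume ?L
    then show ?R
      using equivD(1)[OF eq]
      by (auto simp: mv_congruence_def emv_interval_mv_def interval_zero)
  next
    assume ?R
    let ?J = "emv_interval M \<zero> b"
    have "equiv ?J (\<theta> \<inter> (?J \<times> ?J))"
      by (rule equiv_Int_square[OF eq]) (auto simp: interval_zero)
    moreover have "compatible2 (emv_plus M) (\<theta> \<inter> (?J \<times> ?J))"
      unfolding compatible2_def
      using plus by (auto simp: interval_zero plus_closed plus_below_idempotent[OF b]
          intro: compatible2D)
    ultimately show ?L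
      using \<open>?R\<close> compl_closed[OF b] compl_below[OF b]
      by (auto simp: mv_congruence_def emv_interval_mv_def interval_zero)
  qed
  then show ?thesis unfolding emv_congruence_def by blast
qed

section \<open>Intersections and joins of congruences\<close>

lemma emv_congruenceD:
  assumes "emv_congruence M \<theta>"
  shows "equiv (carrier M) \<theta>" "compatible2 (emv_join M) \<theta>" "compatible2 (emv_meet M) \<theta>"
    "compatible2 (emv_plus M) \<theta>"
    and "\<And>b x y. \<lbrakk>b \<in> emv_idempotents M; (x, y) \<in> \<theta>; x \<preceq> b; y \<preceq> b\<rbrakk>
      \<Longrightarrow> (emv_compl M \<zero> b x, emv_compl M \<zero> b y) \<in> \<theta>"
  using assms by (simp_all add: emv_congruence_iff)

lemma emv_congruence_Int:
  assumes "emv_congruence M \<theta>" "emv_congruence M \<phi>"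
  shows "emv_congruence M (\<theta> \<inter> \<phi>)"
proof -
  have "equiv (carrier M) (\<theta> \<inter> \<phi>)"
    using equiv_Int[OF emv_congruenceD(1) emv_congruenceD(1)] assms by blast
  then show ?thesis
    using emv_congruenceD(2-4)[OF assms(1)] emv_congruenceD(2-4)[OF assms(2)]
      emv_congruenceD(5)[OF assms(1)] emv_congruenceD(5)[OF assms(2)]
    by (simp add: emv_congruence_iff compatible2_Int)
qed

lemma emv_congruence_trancl_Un:
  assumes \<theta>: "emv_congruence M \<theta>" and \<phi>: "emv_congruence M \<phi>"
  shows "emv_congruence M ((\<theta> \<union> \<phi>)\<^sup>+)"
  unfolding emv_congruence_iff
proof (intro conjI ballI allI impI)
  note eq = emv_congruenceD(1)[OF \<theta>] emv_congruenceD(1)[OF \<phi>]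
  show "equiv (carrier M) ((\<theta> \<union> \<phi>)\<^sup>+)" using equiv_trancl_Un[OF eq] .
  show "compatible2 (emv_join M) ((\<theta> \<union> \<phi>)\<^sup>+)" "compatible2 (emv_meet M) ((\<theta> \<union> \<phi>)\<^sup>+)"
    "compatible2 (emv_plus M) ((\<theta> \<union> \<phi>)\<^sup>+)"
    using compatible2_trancl_Un[OF eq] emv_congruenceD(2-4) \<theta> \<phi> by blast+
  fix b x y
  assume b: "b \<in> emv_idempotents M" and xy: "(x, y) \<in> (\<theta> \<union> \<phi>)\<^sup>+"
    and below: "x \<preceq> b" "y \<preceq> b"
  note bc = idempotent_closed[OF b]
  \<comment> \<open>Intermediate elements of the chain may leave [0, b], where the complement is not
    controlled. Meeting with \<open>b\<close> moves every link into [0, b] before complements are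
    taken.\<close>
  have step: "(emv_compl M \<zero> b (u \<^bold>\<and> b), emv_compl M \<zero> b (v \<^bold>\<and> b)) \<in> \<psi>"
    if \<psi>: "emv_congruence M \<psi>" and uv: "(u, v) \<in> \<psi>" for \<psi> u v
  proof -
    note D = emv_congruenceD[OF \<psi>]
    have "u \<in> carrier M" "v \<in> carrier M" using uv equivD(1)[OF D(1)] by auto
    then show ?thesis
      using D(5)[OF b] compatible2D[OF D(3) uv equivD(2)[OF D(1) bc]] meet_below2 bc by blast
  qed
  have "(emv_compl M \<zero> b (x \<^bold>\<and> b), emv_compl M \<zero> b (y \<^bold>\<and> b)) \<in> (\<theta> \<union> \<phi>)\<^sup>+"
    by (rule trancl_map_step[OF xy]) (use step \<theta> \<phi> in blast)
  \<comment> \<open>The end points already lie below \<open>b\<close>, so meeting with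
    \<open>b\<close> fixes them.\<close>
  then show "(emv_compl M \<zero> b x, emv_compl M \<zero> b y) \<in> (\<theta> \<union> \<phi>)\<^sup>+"
    using below by (simp add: below_iff)
qed

lemma trancl_Un_least:
  assumes "emv_congruence M \<psi>" "\<theta> \<subseteq> \<psi>" "\<phi> \<subseteq> \<psi>"
  shows "(\<theta> \<union> \<phi>)\<^sup>+ \<subseteq> \<psi>"
proof -
  have "trans \<psi>" using assms(1) by (simp add: emv_congruence_iff equiv_def)
  then have "\<psi>\<^sup>+ = \<psi>" by (rule trancl_id)
  then show ?thesis using trancl_mono_subset[of "\<theta> \<union> \<phi>" \<psi>] assms(2,3) by blast
qed

section \<open>Distributivity of the congruence lattice\<close>

lemma Int_trancl_Un_subset:
  assumes \<alpha>: "emv_congruence M \<alpha>" and \<beta>: "emv_congruence M \<beta>" and \<gamma>: "emv_congruence M \<gamma>"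
  shows "\<alpha> \<inter> (\<beta> \<union> \<gamma>)\<^sup>+ \<subseteq> ((\<alpha> \<inter> \<beta>) \<union> (\<alpha> \<inter> \<gamma>))\<^sup>+"
proof clarify
  fix x y assume xy: "(x, y) \<in> \<alpha>" and chain: "(x, y) \<in> (\<beta> \<union> \<gamma>)\<^sup>+"
  \<comment> \<open>The median term with its first two arguments fixed at the ends of the
    chain.\<close>
  define m where "m z = (x \<^bold>\<and> y) \<^bold>\<or> (z \<^bold>\<and> (x \<^bold>\<or> y))" for z
  note \<alpha>D = emv_congruenceD[OF \<alpha>]
  have x: "x \<in> carrier M" and y: "y \<in> carrier M" using xy equivD(1)[OF \<alpha>D(1)] by auto
  note closed = meet_closed[OF x y] join_closed[OF x y]
  have m_alpha: "(x, m z) \<in> \<alpha>" if z: "z \<in> carrier M" for z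
  proof -
    \<comment> \<open>Modulo \<alpha> the end \<open>y\<close> may be replaced by \<open>x\<close>,
      and then \<open>m z\<close> becomes x \<or> (z \<and> x), which is x by absorption.\<close>
    have "(x \<^bold>\<and> x, x \<^bold>\<and> y) \<in> \<alpha>" "(x \<^bold>\<or> x, x \<^bold>\<or> y) \<in> \<alpha>"
      using compatible2D[OF \<alpha>D(3) equivD(2)[OF \<alpha>D(1) x] xy]
        compatible2D[OF \<alpha>D(2) equivD(2)[OF \<alpha>D(1) x] xy] by auto
    then have "(x \<^bold>\<or> (z \<^bold>\<and> x), m z) \<in> \<alpha>"
      unfolding m_def
      using compatible2D[OF \<alpha>D(2)] compatible2D[OF \<alpha>D(3) equivD(2)[OF \<alpha>D(1) z]]
      by (simp add: meet_idem[OF x] join_idem[OF x])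
    then show ?thesis using join_absorb[OF x z] meet_comm[OF x z] by simp
  qed
  have step: "(m u, m v) \<in> \<alpha> \<inter> \<psi>"
    if \<psi>: "emv_congruence M \<psi>" and uv: "(u, v) \<in> \<psi>" for \<psi> u v
  proof
    note D = emv_congruenceD[OF \<psi>]
    have "u \<in> carrier M" "v \<in> carrier M" using uv equivD(1)[OF D(1)] by auto
    \<comment> \<open>Both values are \<alpha>-related to \<open>x\<close>, whether or not
      \<open>u\<close> and \<open>v\<close> are.\<close>
    then show "(m u, m v) \<in> \<alpha>" using m_alpha equivD(3,4)[OF \<alpha>D(1)] by blast
    show "(m u, m v) \<in> \<psi>"
      unfolding m_def
      using compatible2D[OF D(2) equivD(2)[OF D(1) closed(1)]]
        compatible2D[OF D(3) uv equivD(2)[OF D(1) closed(2)]] by blast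
  qed
  have "(m x, m y) \<in> ((\<alpha> \<inter> \<beta>) \<union> (\<alpha> \<inter> \<gamma>))\<^sup>+"
    by (rule trancl_map_step[OF chain]) (use step \<beta> \<gamma> in blast)
  \<comment> \<open>By absorption the ends of the chain are fixed by \<open>m\<close>, so the new
    chain still joins \<open>x\<close> to \<open>y\<close>.\<close>
  moreover have "m x = x"
    using meet_absorb[OF x y] join_comm[OF closed(1) x] join_absorb[OF x y]
    by (simp add: m_def)
  moreover have "m y = y"
    using meet_absorb[OF y x] join_comm[OF y x] join_comm[OF closed(1) y]
      meet_comm[OF x y] join_absorb[OF y x] by (simp add: m_def)
  ultimately show "(x, y) \<in> ((\<alpha> \<inter> \<beta>) \<union> (\<alpha> \<inter> \<gamma>))\<^sup>+" by simp
qed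

lemma Con_distributive_lattice: "distributive_lattice (Con M)"
proof -
  let ?F = "{\<theta>. emv_congruence M \<theta>}"
  have meet: "\<theta> \<sqinter>\<^bsub>subset_order ?F\<^esub> \<phi> = \<theta> \<inter> \<phi>"
    if "emv_congruence M \<theta>" "emv_congruence M \<phi>" for \<theta> \<phi>
    using that emv_congruence_Int by (intro meet_subset_order) auto
  have join: "\<theta> \<squnion>\<^bsub>subset_order ?F\<^esub> \<phi> = (\<theta> \<union> \<phi>)\<^sup>+"
    if "emv_congruence M \<theta>" "emv_congruence M \<phi>" for \<theta> \<phi>
    using that emv_congruence_trancl_Un[OF that] trancl_Un_least
    by (intro join_subset_order) auto
  interpret partial_order "subset_order ?F" by (rule partial_order_subset_order)
  have "distributive_lattice (subset_order ?F)"
  proof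
    fix \<theta> \<phi> assume "\<theta> \<in> carrier (subset_order ?F)" "\<phi> \<in> carrier (subset_order ?F)"
    then have \<theta>: "emv_congruence M \<theta>" and \<phi>: "emv_congruence M \<phi>" by auto
    have "least (subset_order ?F) ((\<theta> \<union> \<phi>)\<^sup>+) (Upper (subset_order ?F) {\<theta>, \<phi>})"
      using emv_congruence_trancl_Un[OF \<theta> \<phi>] trancl_Un_least \<theta> \<phi>
      by (intro least_Upper_subset_orderI) auto
    then show "\<exists>s. least (subset_order ?F) s (Upper (subset_order ?F) {\<theta>, \<phi>})" by blast
    show "\<exists>i. greatest (subset_order ?F) i (Lower (subset_order ?F) {\<theta>, \<phi>})"
      using greatest_Lower_Inter[of "{\<theta>, \<phi>}" ?F] emv_congruence_Int \<theta> \<phi> by auto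
  next
    fix \<alpha> \<beta> \<gamma>
    assume "\<alpha> \<in> carrier (subset_order ?F)" "\<beta> \<in> carrier (subset_order ?F)"
      "\<gamma> \<in> carrier (subset_order ?F)"
    then have \<alpha>: "emv_congruence M \<alpha>" and \<beta>: "emv_congruence M \<beta>" and \<gamma>: "emv_congruence M \<gamma>"
      by auto
    note closed = emv_congruence_Int[OF \<alpha> \<beta>] emv_congruence_Int[OF \<alpha> \<gamma>]
      emv_congruence_trancl_Un[OF \<beta> \<gamma>]
    \<comment> \<open>This is the inclusion valid in every lattice; the preceding lemma supplies the
      other one.\<close>
    have "((\<alpha> \<inter> \<beta>) \<union> (\<alpha> \<inter> \<gamma>))\<^sup>+ \<subseteq> \<alpha> \<inter> (\<beta> \<union> \<gamma>)\<^sup>+"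
      using trancl_mono_subset[of "(\<alpha> \<inter> \<beta>) \<union> (\<alpha> \<inter> \<gamma>)" "\<beta> \<union> \<gamma>"]
        trancl_Un_least[OF \<alpha>, of "\<alpha> \<inter> \<beta>" "\<alpha> \<inter> \<gamma>"] by auto
    then have "\<alpha> \<inter> (\<beta> \<union> \<gamma>)\<^sup>+ = ((\<alpha> \<inter> \<beta>) \<union> (\<alpha> \<inter> \<gamma>))\<^sup>+"
      using Int_trancl_Un_subset[OF \<alpha> \<beta> \<gamma>] by blast
    then show "\<alpha> \<sqinter>\<^bsub>subset_order ?F\<^esub> (\<beta> \<squnion>\<^bsub>subset_order ?F\<^esub> \<gamma>)
      = (\<alpha> \<sqinter>\<^bsub>subset_order ?F\<^esub> \<beta>) \<squnion>\<^bsub>subset_order ?F\<^esub> (\<alpha> \<sqinter>\<^bsub>subset_order ?F\<^esub> \<gamma>)"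
      using meet join \<alpha> \<beta> \<gamma> closed by simp
  qed
  then show ?thesis by (simp add: Con_def)
qed

end

theorem theorem5p17:
  fixes M :: "'a emv"
  assumes "emv_algebra M"
  shows "complete_Brouwer_lattice (Ideal M) \<and> distributive_lattice (Con M)"
  using emv_algebra.Ideal_complete_Brouwer_lattice[OF assms]
    emv_algebra.Con_distributive_lattice[OF assms] by blast

end
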